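(* There exists an infinite $(7/3)^+$-power-free word $\mathbf{w}$ over $\{0,1\}$ that contains arbitrarily large squares beginning at every position; that is, for every position $i$ of $\mathbf{w}$ and every $N$, there is a square of length at least $N$ occurring in $\mathbf{w}$ beginning at position $i$.
   Context: A finite word $w$ is an $\alpha$-power ($\alpha$ rational) if $w = x^n x'$ with $x$ nonempty, $x'$ a prefix of $x$, and $\alpha = n + |x'|/|x|$. An $\alpha^+$-power is a word that is a $\beta$-power for some $\beta>\alpha$. A word is $\alpha^+$-power-free if none of its factors (contiguous subwords) is an $\alpha^+$-power. A square is a word $xx$ with $x$ nonempty. *)

theory Defs
  imports Complex_Main "HOL-Library.Sublist"
begin

definition is_power :: "'a list \<Rightarrow> rat \<Rightarrow> bool" where
  "is_power w \<alpha> \<longleftrightarrow> (\<exists>x x' n. x \<noteq> [] \<and> prefix x' x \<and>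
      w = concat (replicate n x) @ x' \<and>
      \<alpha> = of_nat n + of_nat (length x') / of_nat (length x))"

definition is_plus_power :: "'a list \<Rightarrow> rat \<Rightarrow> bool" where
  "is_plus_power w \<alpha> \<longleftrightarrow> (\<exists>\<beta>. \<beta> > \<alpha> \<and> is_power w \<beta>)"

definition factor :: "(nat \<Rightarrow> 'a) \<Rightarrow> nat \<Rightarrow> nat \<Rightarrow> 'a list" where
  "factor w i n = map w [i..<i+n]"

definition plus_power_free_inf :: "(nat \<Rightarrow> 'a) \<Rightarrow> rat \<Rightarrow> bool" where
  "plus_power_free_inf w \<alpha> \<longleftrightarrow> (\<forall>i n. \<not> is_plus_power (factor w i n) \<alpha>)"

definition is_square :: "'a list \<Rightarrow> bool" where
  "is_square u \<longleftrightarrow> (\<exists>x. x \<noteq> [] \<and> u = x @ x)"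

end

theory Submission
  imports Defs
begin

text \<open>
  The word is the fixed point of the 39-uniform morphism that sends 0 to the block below and 1 to its
  complement. The block begins with an overlap of period 15 and length 31; the images of that
  overlap under powers of the morphism are prefixes with period \<open>15 * 39 ^ k\<close> and length
  \<open>31 * 39 ^ k\<close>, so a square of period \<open>15 * 39 ^ k\<close> begins at every position
  up to \<open>39 ^ k\<close>.

  For power-freeness, the changes between consecutive letters inside a block do not depend on the
  block, and no nontrivial cyclic shift of this pattern of changes is consistent with it. Hence a
  repetition of exponent above 7/3 whose period is at least 30 has a period divisible by 39. As the
  two blocks disagree everywhere, it then descends to a repetition of exponent above 7/3 with a
  smaller period. Periods below 30 are excluded by inspecting three consecutive blocks.
\<close>

section \<open>The fixed point of the morphism\<close>

definition block :: "bool list" where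
  "block = map ((=) 1) [0,1,1,0,1,0,0,1,1,0,1,1,0,0,1,0,1,1,0,1,0,0,1,1,0,1,1,0,0,1,0,0,1,1,0,1,0,0,1::nat]"

text \<open>The inequality of booleans acts as exclusive or and complements the block under a letter
  \<open>True\<close>. Position 0 is its own parent, so it ends the recursion; its value fits the
  fixed point because the block starts with \<open>False\<close>.\<close>

function word :: "nat \<Rightarrow> bool" where
  "word i = (if i = 0 then False else word (i div 39) \<noteq> block ! (i mod 39))"
  by auto
termination by (relation "measure id") auto

declare word.simps [simp del]

lemma length_block: "length block = 39"
  by (simp add: block_def)

lemma word_block: "r < 39 \<Longrightarrow> word (39 * i + r) = (word i \<noteq> block ! r)"
  by (subst word.simps) (auto simp: word.simps[of 0] block_def)

text \<open>For p > 0 this is period p of the factor of length m + p at s. Its exponent (m + p)/p is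
  at most 7/3 iff 3m \<le> 4p.\<close>

definition agree :: "(nat \<Rightarrow> 'a) \<Rightarrow> nat \<Rightarrow> nat \<Rightarrow> nat \<Rightarrow> bool" where
  "agree w s p m \<longleftrightarrow> (\<forall>i. s \<le> i \<and> i < s + m \<longrightarrow> w (i + p) = w i)"

lemma agree_mono: "agree w s p m \<Longrightarrow> m' \<le> m \<Longrightarrow> agree w s p m'"
  by (auto simp: agree_def)

lemma agree_word_expand:
  assumes "agree word 0 p m"
  shows "agree word 0 (39 * p) (39 * m)"
  unfolding agree_def
proof (intro allI impI)
  fix i assume i: "0 \<le> i \<and> i < 0 + 39 * m"
  have "word (39 * (i div 39 + p) + i mod 39) = word (39 * (i div 39) + i mod 39)"
    using assms i by (subst (1 2) word_block) (auto simp: agree_def less_mult_imp_div_less mult.commute)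
  moreover have "39 * (i div 39 + p) + i mod 39 = i + 39 * p"
    using div_mult_mod_eq[of i 39] by (simp add: algebra_simps)
  ultimately show "word (i + 39 * p) = word i" by simp
qed

lemma agree_word_descend:
  assumes "agree word s (39 * q) m" "0 < m"
  obtains s' m' where "agree word s' q m'" "m \<le> 39 * m'"
proof
  \<comment> \<open>The last block that the window meets. Blocks met only partly are kept too, so no
    length is lost.\<close>
  define t where "t = (s + m - 1) div 39"
  have st: "s div 39 \<le> t" unfolding t_def using assms(2) by (intro div_le_mono) simp
  show "agree word (s div 39) q (Suc t - s div 39)"
    unfolding agree_def
  proof (intro allI impI)
    fix j assume j: "s div 39 \<le> j \<and> j < s div 39 + (Suc t - s div 39)"
    \<comment> \<open>The first window position in block j. One agreement per block suffices, as the
      images of the two letters differ everywhere.\<close>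
    define i where "i = max s (39 * j)"
    have "39 * j < s + m"
      using j st assms(2) unfolding t_def by (auto simp: less_Suc_eq_le less_eq_div_iff_mult_less_eq)
    hence "s \<le> i" "i < s + m" using assms(2) by (auto simp: i_def)
    hence eq: "word (i + 39 * q) = word i" using assms(1) by (auto simp: agree_def)
    have ij: "i div 39 = j"
      using j div_le_mono[of s "39 * j" 39] by (auto simp: i_def max_def)
    have i: "i = 39 * j + i mod 39" using ij div_mult_mod_eq[of i 39] by simp
    hence "i + 39 * q = 39 * (j + q) + i mod 39" by simp
    with eq i have "word (39 * (j + q) + i mod 39) = word (39 * j + i mod 39)" by metis
    thus "word (j + q) = word j" by (subst (asm) (1 2) word_block) auto
  qed
  have "s + m - 1 < 39 * Suc t" "39 * (s div 39) \<le> s"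
    using dividend_less_times_div[of 39 "s + m - 1"] by (simp_all add: t_def)
  thus "m \<le> 39 * (Suc t - s div 39)"
    using st by (simp add: diff_mult_distrib2)
qed

section \<open>Synchronization: long repetitions have period divisible by 39\<close>

abbreviation change :: "nat \<Rightarrow> bool" where
  "change r \<equiv> block ! r \<noteq> block ! Suc r"

text \<open>Residue 38 is avoided on both sides: a change there crosses a block boundary and is not
  determined by the block.\<close>

lemma block_synchronized:
  "\<forall>c\<in>set [1..<39]. \<exists>r\<in>set [0..<38]. (r + c) mod 39 \<noteq> 38 \<and> change r \<noteq> change ((r + c) mod 39)"
  by code_simp

lemma word_change:
  assumes "i mod 39 \<noteq> 38"
  shows "(word i \<noteq> word (Suc i)) = change (i mod 39)"
proof -
  have "i mod 39 < 39" by simp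
  with assms have *: "Suc (i mod 39) < 39" by linarith
  have "word (39 * (i div 39) + i mod 39) = (word (i div 39) \<noteq> block ! (i mod 39))"
    by (rule word_block) simp
  moreover have "word (39 * (i div 39) + Suc (i mod 39)) = (word (i div 39) \<noteq> block ! Suc (i mod 39))"
    using * by (rule word_block)
  ultimately show ?thesis by auto
qed

lemma agree_word_dvd:
  assumes "agree word s p 40"
  shows "39 dvd p"
proof (rule ccontr)
  assume "\<not> 39 dvd p"
  define c where "c = p mod 39"
  have "c \<in> set [1..<39]" using \<open>\<not> 39 dvd p\<close> by (auto simp: c_def dvd_eq_mod_eq_0)
  then obtain r where "r \<in> set [0..<38]"
    and r: "(r + c) mod 39 \<noteq> 38" "change r \<noteq> change ((r + c) mod 39)"
    using block_synchronized by blast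
  hence "r < 38" by (simp only: set_upt atLeastLessThan_iff)
  obtain a e where s: "s = 39 * a + e" "e < 39"
    by (metis mult_div_mod_eq mod_less_divisor zero_less_numeral)
  \<comment> \<open>The first position from s on with residue r. It is below s + 39, so 40
    agreements cover both i and its successor.\<close>
  define i where "i = 39 * (if e \<le> r then a else Suc a) + r"
  have "i mod 39 = r" "s \<le> i" "i < s + 39" using \<open>r < 38\<close> s by (auto simp: i_def)
  have "(i + p) mod 39 = (r + c) mod 39" using \<open>i mod 39 = r\<close> unfolding c_def by (metis mod_add_eq)
  have "word (i + p) = word i" "word (Suc i + p) = word (Suc i)"
    using assms[unfolded agree_def, rule_format, of i]
      assms[unfolded agree_def, rule_format, of "Suc i"] \<open>s \<le> i\<close> \<open>i < s + 39\<close> by simp_all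
  moreover have "(word i \<noteq> word (Suc i)) = change r"
    using word_change[of i] \<open>r < 38\<close> \<open>i mod 39 = r\<close> by simp
  moreover have "(word (i + p) \<noteq> word (Suc (i + p))) = change ((r + c) mod 39)"
    using word_change[of "i + p"] r \<open>(i + p) mod 39 = _\<close> by simp
  ultimately show False using r(2) by simp
qed

section \<open>Periods below 30\<close>

text \<open>Every maximal run of \<open>True\<close> has length at most \<open>m\<close>, and a run at
  the front has length at most \<open>c\<close>.\<close>

fun runs_le :: "nat \<Rightarrow> nat \<Rightarrow> bool list \<Rightarrow> bool" where
  "runs_le m c [] = True"
| "runs_le m c (b # bs) = (if b then (case c of 0 \<Rightarrow> False | Suc c' \<Rightarrow> runs_le m c' bs) else runs_le m m bs)"

lemma runs_leD:
  assumes "runs_le m c bs" "c \<le> m" "s + m < length bs"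
  shows "\<exists>i\<in>{s..s + m}. \<not> bs ! i"
proof -
  have front: "\<exists>i\<le>c. \<not> bs ! i" if "runs_le m c bs" "c < length bs" for c bs
    using that
  proof (induction m c bs rule: runs_le.induct)
    case (2 m c b bs)
    show ?case
    proof (cases b)
      case True
      then obtain c' where c': "c = Suc c'" "runs_le m c' bs" using 2 by (auto split: nat.splits)
      then obtain i where "i \<le> c'" "\<not> bs ! i" using 2 True by auto
      thus ?thesis using c' by (intro exI[of _ "Suc i"]) auto
    qed (auto intro: exI[of _ 0])
  qed simp
  \<comment> \<open>Scanning past a prefix leaves an allowance of at most m, so \<open>front\<close>
    applies to the rest.\<close>
  have tail: "\<exists>c'\<le>m. runs_le m c' (drop s bs)" if "runs_le m c bs" "c \<le> m" for s c bs
    using that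
  proof (induction s arbitrary: c bs)
    case (Suc s)
    thus ?case by (cases bs) (auto split: if_splits nat.splits intro: Suc_leD)
  qed auto
  obtain c' where "c' \<le> m" "runs_le m c' (drop s bs)" using tail assms by blast
  moreover from this obtain i where "i \<le> c'" "\<not> drop s bs ! i"
    using front[of c' "drop s bs"] assms by fastforce
  ultimately show ?thesis using assms by (intro bexI[of _ "s + i"]) auto
qed

definition blocks :: "bool \<Rightarrow> bool \<Rightarrow> bool \<Rightarrow> bool list" where
  "blocks x y z = map ((\<noteq>) x) block @ map ((\<noteq>) y) block @ map ((\<noteq>) z) block"

text \<open>The zipped list marks the agreements at distance p; a run longer than 4p/3 means an
  exponent above 7/3.\<close>

definition short_periods_ok :: "bool list \<Rightarrow> nat list \<Rightarrow> bool" where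
  "short_periods_ok u ps \<longleftrightarrow>
     list_all (\<lambda>p. runs_le (4 * p div 3) (4 * p div 3) (map2 (=) u (drop p u))) ps"

lemma blocks_period_1: "\<forall>x y z. short_periods_ok (blocks x y z) [1]"
  by code_simp

lemma blocks_short_periods:
  "\<forall>x y z. \<not> (x = y \<and> y = z) \<longrightarrow> short_periods_ok (blocks x y z) [2..<30]"
  by code_simp

lemma word_blocks:
  assumes "t < 117"
  shows "word (39 * b + t) = blocks (word b) (word (Suc b)) (word (Suc (Suc b))) ! t"
proof -
  consider "t < 39" | "39 \<le> t" "t < 78" | "78 \<le> t" by linarith
  thus ?thesis
  proof cases
    case 1
    thus ?thesis by (simp add: word_block blocks_def nth_append length_block)
  next
    case 2
    hence "t - 39 < 39" by linarith
    thus ?thesis using 2 word_block[of "t - 39" "Suc b"]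
      by (simp add: blocks_def nth_append length_block)
  next
    case 3
    hence "t - 78 < 39" "\<not> t - 39 < 39" using assms by linarith+
    thus ?thesis using 3 word_block[of "t - 78" "Suc (Suc b)"]
      by (simp add: blocks_def nth_append length_block)
  qed
qed

lemma length_blocks: "length (blocks x y z) = 117"
  by (simp add: blocks_def length_block)

lemma agree_word_short:
  assumes "agree word s p m" "0 < p" "p < 30"
    and not_cube: "1 < p \<Longrightarrow> \<not> (word b = word (Suc b) \<and> word (Suc b) = word (Suc (Suc b)))"
    and b: "b = s div 39"
  shows "3 * m \<le> 4 * p"
proof (rule ccontr)
  assume "\<not> 3 * m \<le> 4 * p"
  define k where "k = 4 * p div 3"
  \<comment> \<open>Since p \<le> 29, k is at most 38. With a starting offset of at most 38, all
    positions compared are at most 38 + 38 + 29 = 105 < 117, so three blocks suffice.\<close>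
  have "Suc k \<le> m" "k < 39" using \<open>\<not> _\<close> assms(3) unfolding k_def by presburger+
  hence ag: "agree word s p (Suc k)" using assms(1) agree_mono by blast
  define u where "u = blocks (word b) (word (Suc b)) (word (Suc (Suc b)))"
  have len: "length u = 117" by (simp add: u_def length_blocks)
  have "runs_le k k (map2 (=) u (drop p u))"
  proof (cases "p = 1")
    case True
    have "short_periods_ok u [1]" using blocks_period_1 unfolding u_def by blast
    thus ?thesis using True by (simp add: short_periods_ok_def k_def)
  next
    case False
    hence "1 < p" using assms(2) by linarith
    hence "p \<in> set [2..<30]" unfolding set_upt atLeastLessThan_iff using assms(3) by linarith
    moreover have "short_periods_ok u [2..<30]"
      unfolding u_def using not_cube[OF \<open>1 < p\<close>] by (rule blocks_short_periods[rule_format])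
    ultimately show ?thesis unfolding short_periods_ok_def list_all_iff k_def by (rule bspec[rotated])
  qed
  moreover have r: "s mod 39 < 39" by simp
  ultimately obtain i where i: "i \<in> {s mod 39..s mod 39 + k}" "\<not> map2 (=) u (drop p u) ! i"
    using runs_leD[of k k "map2 (=) u (drop p u)" "s mod 39"] len \<open>k < 39\<close> assms(3) by force
  have ip: "i + p < 117" using i(1) r \<open>k < 39\<close> assms(3) unfolding atLeastAtMost_iff by linarith
  hence "u ! i \<noteq> u ! (i + p)" using i(2) len by (simp add: add.commute)
  hence "word (39 * b + i) \<noteq> word (39 * b + i + p)"
    using word_blocks[of i b] word_blocks[of "i + p" b] ip by (simp add: u_def add.assoc)
  moreover have "s \<le> 39 * b + i" "39 * b + i < s + Suc k"
    using i(1) mult_div_mod_eq[of 39 s] unfolding b atLeastAtMost_iff by linarith+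
  ultimately show False using ag unfolding agree_def by metis
qed

lemma agree_word_bound:
  assumes "agree word s p m" "0 < p"
  shows "3 * m \<le> 4 * p"
  using assms
proof (induction p arbitrary: s m rule: less_induct)
  case (less p)
  show ?case
  proof (cases "p < 30")
    case True
    have "\<not> (word b = word (Suc b) \<and> word (Suc b) = word (Suc (Suc b)))" if "1 < p" for b
    proof
      assume "word b = word (Suc b) \<and> word (Suc b) = word (Suc (Suc b))"
      hence "agree word b 1 2" by (auto simp: agree_def less_Suc_eq numeral_2_eq_2 le_Suc_eq)
      with less.IH[OF that] show False by fastforce
    qed
    thus ?thesis using agree_word_short[OF less.prems True _ refl] by blast
  next
    case False
    show ?thesis
    proof (rule ccontr)
      assume large: "\<not> ?thesis"
      \<comment> \<open>Here 3m > 4p \<ge> 120, so there are more than the 40 agreements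
        needed.\<close>
      hence "39 dvd p" using False less.prems agree_mono[of word s p m 40] by (auto intro: agree_word_dvd)
      then obtain q where q: "p = 39 * q" by blast
      obtain s' m' where "agree word s' q m'" "m \<le> 39 * m'"
        using less.prems(1) large unfolding q by (rule_tac agree_word_descend) auto
      \<comment> \<open>The ratio survives the descent: 3m \<le> 39 * 3m' \<le> 39 * 4q =
        4p.\<close>
      with less.IH[of q] less.prems(2) q large show False by fastforce
    qed
  qed
qed

section \<open>Translation to powers and squares\<close>

lemma nth_power:
  assumes "prefix x' x" "j < length (concat (replicate n x) @ x')"
  shows "(concat (replicate n x) @ x') ! j = x ! (j mod length x)"
  using assms(2)
proof (induction n arbitrary: j)
  case 0
  thus ?case using assms(1) by (auto simp: prefix_def nth_append)
next
  case (Suc n)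
  thus ?case by (cases "j < length x") (auto simp: nth_append le_mod_geq)
qed

lemma plus_power_free_infI:
  assumes "\<And>s p m. agree w s p m \<Longrightarrow> 0 < p \<Longrightarrow> of_nat (m + p) \<le> \<alpha> * of_nat p"
  shows "plus_power_free_inf w \<alpha>"
  unfolding plus_power_free_inf_def is_plus_power_def is_power_def
proof (intro allI notI, elim exE conjE)
  fix s L \<beta> x x' n
  assume \<beta>: "\<alpha> < \<beta>" "\<beta> = of_nat n + of_nat (length x') / of_nat (length x)"
    and x: "x \<noteq> []" "prefix x' x" and u: "factor w s L = concat (replicate n x) @ x'"
  define p where "p = length x"
  have p: "0 < p" using x by (simp add: p_def)
  have L: "L = n * p + length x'"
    using arg_cong[OF u, of length] by (simp add: factor_def p_def length_concat sum_list_replicate)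
  have nth: "w (s + j) = x ! (j mod p)" if "j < L" for j
    using that nth_power[OF x(2), of j n] u L
    by (simp add: factor_def p_def length_concat sum_list_replicate flip: u)
  have "agree w s p (L - p)"
    unfolding agree_def
  proof (intro allI impI)
    fix i assume "s \<le> i \<and> i < s + (L - p)"
    then obtain j where "i = s + j" "j + p < L" by (auto simp: le_iff_add)
    thus "w (i + p) = w i" using nth[of j] nth[of "j + p"] by (simp add: add.assoc)
  qed
  \<comment> \<open>Only L \<le> (L - p) + p is used: for n = 0 the power may be shorter than p and
    the subtraction truncates.\<close>
  from assms[OF this p] have "of_nat L \<le> \<alpha> * of_nat p"
    by (rule order_trans[rotated]) simp
  moreover have "of_nat L = \<beta> * of_nat p"
    using p unfolding \<beta> L p_def by (simp add: field_simps)
  ultimately show False using \<beta>(1) p by simp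
qed

lemma is_square_factor:
  assumes "agree w 0 p m" "0 < p" "i + p \<le> m"
  shows "is_square (factor w i (2 * p))"
proof -
  have "factor w i (2 * p) = factor w i p @ factor w (i + p) p"
    using upt_add_eq_append[of i "i + p" p] by (simp add: factor_def mult_2 add.assoc)
  moreover have "factor w (i + p) p = factor w i p"
  proof (rule nth_equalityI)
    fix j assume "j < length (factor w (i + p) p)"
    hence "j < p" by (simp add: factor_def)
    moreover from this have "w (i + j + p) = w (i + j)" using assms by (simp add: agree_def)
    ultimately show "factor w (i + p) p ! j = factor w i p ! j" by (simp add: factor_def ac_simps)
  qed (simp add: factor_def)
  moreover have "factor w i p \<noteq> []" using assms(2) by (simp add: factor_def)
  ultimately show ?thesis unfolding is_square_def by auto
qed

text \<open>The overlap of length 31 and period 15 gives 16 agreements. The one beyond 15 scales to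
  39^k, which is the room for moving the start of the square.\<close>

lemma agree_word_prefix: "agree word 0 (15 * 39 ^ k) (16 * 39 ^ k)"
proof (induction k)
  case 0
  have "list_all (\<lambda>i. block ! (i + 15) = block ! i) [0..<16]" by code_simp
  hence "block ! (i + 15) = block ! i" if "i < 16" for i
    using that by (simp add: list_all_iff del: upt_rec_numeral)
  moreover have "word r = block ! r" if "r < 39" for r
    using word_block[OF that, of 0] by (simp add: word.simps[of 0])
  ultimately have "word (i + 15) = word i" if "i < 16" for i using that by simp
  thus ?case by (simp add: agree_def)
next
  case (Suc k)
  from agree_word_expand[OF Suc] show ?case by simp
qed

theorem theorem4:
  shows "\<exists>w :: nat \<Rightarrow> bool. plus_power_free_inf w (7/3) \<and>
           (\<forall>i N. \<exists>n\<ge>N. is_square (factor w i n))"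
proof (rule exI[of _ word], rule conjI, goal_cases)
  case 1
  show ?case
  proof (rule plus_power_free_infI)
    fix s p m assume "agree word s p m" "0 < p"
    from agree_word_bound[OF this] have "of_nat (3 * m) \<le> (of_nat (4 * p) :: rat)"
      by (simp only: of_nat_le_iff)
    thus "of_nat (m + p) \<le> (7/3 :: rat) * of_nat p" by simp
  qed
next
  case 2
  show ?case
  proof (intro allI)
    fix i N :: nat
    \<comment> \<open>One exponent serves both demands: 39^k exceeds i and N.\<close>
    define k where "k = i + N"
    have k: "k < 39 ^ k" by (rule less_exp[THEN less_le_trans]) (simp add: power_mono)
    have "is_square (factor word i (2 * (15 * 39 ^ k)))"
      by (rule is_square_factor[OF agree_word_prefix[of k]]) (use k in \<open>auto simp: k_def\<close>)
    moreover have "N \<le> 2 * (15 * 39 ^ k)" using k by (simp add: k_def)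
    ultimately show "\<exists>n\<ge>N. is_square (factor word i n)" by blast
  qed
qed

end
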